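(* There exist a problem instance of the averaging reference mechanism (ARM) with linear base demand $H(p)=b-ap$ and loss-neutral customers ($\eta^+=\eta^-$), consisting of a price upper bound $\bar p>0$, parameters $a,b$ and $\eta^+=\eta^-=\eta\ge 0$, together with an initial reference price $r_1\in[0,\bar p]$, such that for every fixed-price policy $\mathbf p=(p,\dots,p)$ with $p\in[0,\bar p]$, $$V^*(r_1)-V^{\mathbf p}(r_1)=\Omega(T),$$ i.e. there are constants $c>0$ and $T_0$ (independent of $T$ and $p$) such that for all horizons $T\ge T_0$ and all $p\in[0,\bar p]$ one has $V^*(r_1)-V^{(p,\dots,p)}(r_1)\ge cT$.
   Context: A seller sets prices $p_t\in[0,\bar p]$ for $t=1,\dots,T$, where $0<\bar p<\infty$. Write $x^+=\max\{x,0\}$. The expected demand at price $p$ and reference price $r$ is $D(p,r)=H(p)+\eta^+(r-p)^+-\eta^-(p-r)^+$ with $\eta^+,\eta^-\ge 0$, and it is assumed that $D(p,r)\ge 0$ for all $p,r\in[0,\bar p]$. Here the base demand is $H(p)=b-ap$. The single-round expected revenue is $\mathrm{Rev}(p,r)=p\,D(p,r)$. Under ARM, starting from reference price $r_1$, reference prices evolve by $r_{t+1}=\frac{t r_t+p_t}{t+1}$ (equivalently $r_{t+1}=\frac{r_1+\sum_{s=1}^t p_s}{t+1}$). For a price sequence $\mathbf p=(p_1,\dots,p_T)\in[0,\bar p]^T$, $V^{\mathbf p}(r_1)=\sum_{t=1}^T\mathrm{Rev}(p_t,r_t)$, and $V^*(r_1)=\sup_{\mathbf p\in[0,\bar p]^T}V^{\mathbf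 p}(r_1)$. *)

theory Defs
  imports "HOL-Analysis.Analysis"
begin

definition pos_part :: "real \<Rightarrow> real" where
  "pos_part x = max x 0"

definition linear_base_demand :: "real \<Rightarrow> real \<Rightarrow> real \<Rightarrow> real" where
  "linear_base_demand a b p = b - a * p"

definition demand :: "(real \<Rightarrow> real) \<Rightarrow> real \<Rightarrow> real \<Rightarrow> real \<Rightarrow> real \<Rightarrow> real" where
  "demand H \<eta>p \<eta>m p r = H p + \<eta>p * pos_part (r - p) - \<eta>m * pos_part (p - r)"

definition revenue :: "(real \<Rightarrow> real) \<Rightarrow> real \<Rightarrow> real \<Rightarrow> real \<Rightarrow> real \<Rightarrow> real" where
  "revenue H \<eta>p \<eta>m p r = p * demand H \<eta>p \<eta>m p r"

definition valid_instance :: "real \<Rightarrow> (real \<Rightarrow> real) \<Rightarrow> real \<Rightarrow> real \<Rightarrow> bool" where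
  "valid_instance pbar H \<eta>p \<eta>m \<longleftrightarrow>
     0 < pbar \<and> 0 \<le> \<eta>p \<and> 0 \<le> \<eta>m \<and>
     (\<forall>p\<in>{0..pbar}. \<forall>r\<in>{0..pbar}. 0 \<le> demand H \<eta>p \<eta>m p r)"

text \<open>Rounds are numbered from 1; the value at index 0 is a dummy. The last equation is
  $r_{s+1} = (s r_s + p_s)/(s+1)$ at $s = t + 1$.\<close>

fun arm_ref :: "real \<Rightarrow> (nat \<Rightarrow> real) \<Rightarrow> nat \<Rightarrow> real" where
  "arm_ref r1 p 0 = r1"
| "arm_ref r1 p (Suc 0) = r1"
| "arm_ref r1 p (Suc (Suc t)) =
     (real (Suc t) * arm_ref r1 p (Suc t) + p (Suc t)) / (real (Suc t) + 1)"

definition arm_value ::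
  "(real \<Rightarrow> real) \<Rightarrow> real \<Rightarrow> real \<Rightarrow> nat \<Rightarrow> (nat \<Rightarrow> real) \<Rightarrow> real \<Rightarrow> real" where
  "arm_value H \<eta>p \<eta>m T p r1 = (\<Sum>t=1..T. revenue H \<eta>p \<eta>m (p t) (arm_ref r1 p t))"

text \<open>A price vector of length $T$ is a function on the naturals of which only the values on
  \<open>{1..T}\<close> are constrained and used. The supremum is over a nonempty set of reals, bounded above
  for linear base demand by \<open>bdd_above_arm_value\<close> below.\<close>

definition arm_opt ::
  "real \<Rightarrow> (real \<Rightarrow> real) \<Rightarrow> real \<Rightarrow> real \<Rightarrow> nat \<Rightarrow> real \<Rightarrow> real" where
  "arm_opt pbar H \<eta>p \<eta>m T r1 =
     (SUP p \<in> {1..T} \<rightarrow> {0..pbar}. arm_value H \<eta>p \<eta>m T p r1)"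

lemma arm_ref_closed_form:
  "arm_ref r1 p (Suc t) = (r1 + (\<Sum>s=1..t. p s)) / (real t + 1)"
proof (induction t)
  case (Suc t)
  have "real (Suc t) * arm_ref r1 p (Suc t) = r1 + (\<Sum>s=1..t. p s)"
    unfolding Suc.IH by (simp add: field_simps)
  then show ?case by (simp add: add.assoc)
qed simp

lemma arm_ref_in_range:
  assumes "r1 \<in> {0..pbar}" and p: "p \<in> {1..T} \<rightarrow> {0..pbar}" and "t \<le> T"
  shows "arm_ref r1 p t \<in> {0..pbar}"
proof (cases t)
  case 0
  then show ?thesis using assms by simp
next
  case (Suc n)
  have pr: "0 \<le> p s \<and> p s \<le> pbar" if "s \<in> {1..n}" for s
    using p that Suc \<open>t \<le> T\<close> by (auto simp: Pi_iff)
  have "0 \<le> (\<Sum>s=1..n. p s)" by (rule sum_nonneg) (use pr in auto)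
  moreover have "(\<Sum>s=1..n. p s) \<le> real n * pbar"
    using sum_bounded_above[of "{1..n}" p pbar] pr by auto
  ultimately show ?thesis
    using assms(1) unfolding Suc arm_ref_closed_form by (auto simp: field_simps)
qed

lemma bdd_above_arm_value:
  assumes "0 \<le> pbar" "0 \<le> \<eta>p" "0 \<le> \<eta>m" and r1: "r1 \<in> {0..pbar}"
  shows "bdd_above ((\<lambda>p. arm_value (linear_base_demand a b) \<eta>p \<eta>m T p r1)
           ` ({1..T} \<rightarrow> {0..pbar}))"
proof (rule bdd_aboveI2)
  fix p assume p: "p \<in> {1..T} \<rightarrow> {0..pbar}"
  let ?B = "pbar * (\<bar>b\<bar> + \<bar>a\<bar> * pbar + \<eta>p * pbar)"
  have "revenue (linear_base_demand a b) \<eta>p \<eta>m (p t) (arm_ref r1 p t) \<le> ?B"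
    if t: "t \<in> {1..T}" for t
  proof -
    have pt: "0 \<le> p t" "p t \<le> pbar" using p t by (auto simp: Pi_iff)
    have rt: "0 \<le> arm_ref r1 p t" "arm_ref r1 p t \<le> pbar"
      using arm_ref_in_range[OF r1 p, of t] t by auto
    have "- (a * p t) \<le> \<bar>a\<bar> * p t"
      using abs_ge_minus_self[of "a * p t"] pt by (simp add: abs_mult)
    also have "\<dots> \<le> \<bar>a\<bar> * pbar" using pt by (intro mult_left_mono) auto
    finally have 1: "- (a * p t) \<le> \<bar>a\<bar> * pbar" .
    have 2: "\<eta>p * pos_part (arm_ref r1 p t - p t) \<le> \<eta>p * pbar"
      using assms pt rt by (intro mult_left_mono) (auto simp: pos_part_def)
    have 3: "0 \<le> \<eta>m * pos_part (p t - arm_ref r1 p t)"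
      using assms by (simp add: pos_part_def)
    have D: "demand (linear_base_demand a b) \<eta>p \<eta>m (p t) (arm_ref r1 p t)
        \<le> \<bar>b\<bar> + \<bar>a\<bar> * pbar + \<eta>p * pbar"
      using 1 2 3 unfolding demand_def linear_base_demand_def by linarith
    have "0 \<le> \<bar>b\<bar> + \<bar>a\<bar> * pbar + \<eta>p * pbar" using assms by simp
    then show ?thesis
      unfolding revenue_def
      using mult_left_mono[OF D pt(1)] mult_right_mono[OF pt(2)] by (meson order_trans)
  qed
  then show "arm_value (linear_base_demand a b) \<eta>p \<eta>m T p r1 \<le> real T * ?B"
    unfolding arm_value_def
    using sum_bounded_above[of "{1..T}"
        "\<lambda>t. revenue (linear_base_demand a b) \<eta>p \<eta>m (p t) (arm_ref r1 p t)" ?B]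
    by simp
qed

end

theory Submission
  imports Defs
begin

text \<open>Take \<open>pbar = 1\<close>, \<open>H(p) = 3 - p\<close>, \<open>\<eta> = 2\<close> and \<open>r\<^sub>1 = 1\<close>. A fixed price \<open>p\<close> earns at most
  \<open>max p (3 - p) = 2\<close> per round, up to a transient: since the reference price is
  \<open>p + (1 - p) / t\<close>, the bound 2 holds exactly from round 2 on. A single markdown does better:
  charging 1 keeps the reference price at 1 and earns 2 per round, and charging \<open>5/6\<close> against a
  reference price \<open>r\<close> earns \<open>5/12 + 5 r / 3\<close>, which is at least \<open>2 + 1/27\<close> as long as
  \<open>r \<ge> 35/36\<close>. The averaged reference price stays that high if the markdown is confined to the
  last sixth of the horizon.\<close>

text \<open>Since \<open>pos_part x - pos_part (- x) = x\<close>, equal coefficients merge the gain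
  and loss terms into one linear term.\<close>

lemma revenue_loss_neutral:
  "revenue (linear_base_demand a b) \<eta> \<eta> p r = p * (b - a * p + \<eta> * (r - p))"
  by (auto simp: revenue_def demand_def linear_base_demand_def pos_part_def max_def algebra_simps)

text \<open>Demand is nonincreasing in \<open>p\<close> and nondecreasing in \<open>r\<close>, so
  the worst case is \<open>p = pbar\<close>, \<open>r = 0\<close>.\<close>

lemma valid_instance_loss_neutral:
  assumes "0 < pbar" "0 \<le> a" "0 \<le> \<eta>" "(a + \<eta>) * pbar \<le> b"
  shows "valid_instance pbar (linear_base_demand a b) \<eta> \<eta>"
  unfolding valid_instance_def
proof (intro conjI ballI)
  fix p r assume p: "p \<in> {0..pbar}" and r: "r \<in> {0..pbar}"
  have "(a + \<eta>) * p \<le> (a + \<eta>) * pbar"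
    using assms p by (intro mult_left_mono) auto
  moreover have "0 \<le> \<eta> * r" using assms r by simp
  moreover have "demand (linear_base_demand a b) \<eta> \<eta> p r = b - (a + \<eta>) * p + \<eta> * r"
    by (auto simp: demand_def linear_base_demand_def pos_part_def max_def algebra_simps)
  ultimately show "0 \<le> demand (linear_base_demand a b) \<eta> \<eta> p r"
    using assms(4) by linarith
qed (use assms in auto)

lemma arm_ref_const:
  "arm_ref r1 (\<lambda>_. p) (Suc t) = p + (r1 - p) / real (Suc t)"
  by (simp add: arm_ref_closed_form field_simps)

lemma arm_value_le_arm_opt:
  assumes "0 \<le> pbar" "0 \<le> \<eta>p" "0 \<le> \<eta>m" "r1 \<in> {0..pbar}" "p \<in> {1..T} \<rightarrow> {0..pbar}"
  shows "arm_value (linear_base_demand a b) \<eta>p \<eta>m T p r1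
    \<le> arm_opt pbar (linear_base_demand a b) \<eta>p \<eta>m T r1"
  unfolding arm_opt_def by (intro cSUP_upper bdd_above_arm_value assms)

text \<open>The summand 1 pays for round 1, the only round whose revenue can exceed 2.\<close>

lemma fixed_price_value_le:
  assumes p: "p \<in> {0..1}"
  shows "arm_value (linear_base_demand 1 3) 2 2 T (\<lambda>_. p) 1 \<le> 2 * real T + 1"
proof (induction T)
  case (Suc T)
  let ?rev = "revenue (linear_base_demand 1 3) 2 2 p (arm_ref 1 (\<lambda>_. p) (Suc T))"
  have step: "arm_value (linear_base_demand 1 3) 2 2 (Suc T) (\<lambda>_. p) 1
      = arm_value (linear_base_demand 1 3) 2 2 T (\<lambda>_. p) 1 + ?rev"
    by (simp add: arm_value_def)
  have rev: "?rev = 2 - (1 - p) * (2 - p - 2 * p / real (Suc T))"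
    unfolding revenue_loss_neutral arm_ref_const by (simp add: field_simps)
  show ?case
  proof (cases "T = 0")
    case True
    \<comment> \<open>In round 1 the revenue is \<open>p * (5 - 3 * p)\<close>; completing the
      square bounds it by 25/12.\<close>
    have "0 \<le> (p - 5/6)\<^sup>2" by simp
    then have "?rev \<le> 3" unfolding rev using True
      by (simp add: power2_eq_square algebra_simps)
    with True step show ?thesis by (simp add: arm_value_def)
  next
    case False
    \<comment> \<open>Now \<open>Suc T\<close> is at least 2, which makes the second factor in
      \<open>rev\<close> at least \<open>2 - 2 * p\<close>.\<close>
    then have "2 * p / real (Suc T) \<le> p"
      using p mult_right_mono[of 2 "real (Suc T)" p] by (simp add: divide_le_eq algebra_simps)
    then have "0 \<le> (1 - p) * (2 - p - 2 * p / real (Suc T))"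
      using p by (intro mult_nonneg_nonneg) auto
    then have "?rev \<le> 2" using rev by linarith
    with Suc.IH step show ?thesis by simp
  qed
qed (simp add: arm_value_def)

definition markdown :: "nat \<Rightarrow> real \<Rightarrow> real \<Rightarrow> nat \<Rightarrow> real" where
  "markdown m x y t = (if t \<le> m then x else y)"

lemma sum_markdown:
  "(\<Sum>s=1..m + k. markdown m x y s) = real m * x + real k * y"
proof (induction k)
  case 0
  have "(\<Sum>s=1..m. markdown m x y s) = (\<Sum>s=1..m. x)"
    by (intro sum.cong) (auto simp: markdown_def)
  then show ?case by simp
qed (simp add: markdown_def algebra_simps)

text \<open>Only copies of \<open>x\<close> are averaged. Round \<open>Suc m\<close> is included
  because its reference price depends on the first \<open>m\<close> prices alone.\<close>

lemma arm_ref_markdown_before: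
  assumes "1 \<le> t" "t \<le> Suc m"
  shows "arm_ref x (markdown m x y) t = x"
proof -
  obtain k where k: "t = Suc k" using assms by (cases t) auto
  have "(\<Sum>s=1..k. markdown m x y s) = (\<Sum>s=1..k. x)"
    using assms k by (intro sum.cong) (auto simp: markdown_def)
  then show ?thesis by (simp add: k arm_ref_closed_form field_simps)
qed

text \<open>The initial reference price acts as one more price \<open>x\<close>, so \<open>k\<close>
  of the \<open>m + k + 1\<close> averaged terms equal \<open>y\<close>.\<close>

lemma arm_ref_markdown_after:
  "arm_ref x (markdown m x y) (Suc (m + k))
    = x - (x - y) * real k / real (Suc (m + k))"
  unfolding arm_ref_closed_form sum_markdown by (simp add: field_simps)

lemma markdown_value_ge:
  assumes "n \<le> Suc m div 5"
  shows "2 * real (m + n) + real n / 27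
    \<le> arm_value (linear_base_demand 1 3) 2 2 (m + n) (markdown m 1 (5/6)) 1"
  using assms
proof (induction n)
  case 0
  have "arm_value (linear_base_demand 1 3) 2 2 m (markdown m 1 (5/6)) 1 = (\<Sum>t=1..m. 2)"
    unfolding arm_value_def revenue_loss_neutral
    by (intro sum.cong) (auto simp: arm_ref_markdown_before markdown_def)
  then show ?case by simp
next
  case (Suc n)
  let ?r = "arm_ref 1 (markdown m 1 (5/6)) (Suc (m + n))"
  have "5 * n \<le> Suc m" using Suc.prems by linarith
  then have "5 * real n \<le> real m + 1" by linarith
  \<comment> \<open>At most one sixth of the averaged terms are marked down, each by 1/6, so the
    reference price drops by at most 1/36.\<close>
  then have r: "35/36 \<le> ?r"
    unfolding arm_ref_markdown_after by (simp add: field_simps)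
  have "revenue (linear_base_demand 1 3) 2 2 (markdown m 1 (5/6) (Suc (m + n))) ?r
      = 5/12 + 5/3 * ?r"
    unfolding revenue_loss_neutral by (simp add: markdown_def)
  moreover have "arm_value (linear_base_demand 1 3) 2 2 (m + Suc n) (markdown m 1 (5/6)) 1
      = arm_value (linear_base_demand 1 3) 2 2 (m + n) (markdown m 1 (5/6)) 1
        + revenue (linear_base_demand 1 3) 2 2 (markdown m 1 (5/6) (Suc (m + n))) ?r"
    by (simp add: arm_value_def)
  moreover have "2 * real (m + n) + real n / 27
    \<le> arm_value (linear_base_demand 1 3) 2 2 (m + n) (markdown m 1 (5/6)) 1"
    using Suc by simp
  ultimately have "2 * real (m + n) + real n / 27 + (2 + 1 / 27)
      \<le> arm_value (linear_base_demand 1 3) 2 2 (m + Suc n) (markdown m 1 (5/6)) 1"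
    using r by linarith
  then show ?case by (simp add: add_divide_distrib)
qed

lemma arm_opt_ge:
  "2 * real T + real T / 162 - 5 / 162 \<le> arm_opt 1 (linear_base_demand 1 3) 2 2 T 1"
proof -
  define n where "n = T div 6"
  define m where "m = T - n"
  have T: "T = m + n" by (simp add: m_def n_def)
  have n: "n \<le> Suc m div 5" by (simp add: m_def n_def)
  \<comment> \<open>Rounding \<open>T / 6\<close> down loses at most 5/6 of a round, whence the
    correction \<open>5 / 162\<close>.\<close>
  have "T \<le> 6 * n + 5" by (simp add: n_def)
  then have "real T \<le> 6 * real n + 5" by linarith
  then have "real T / 162 - 5 / 162 \<le> real n / 27" by simp
  then have "2 * real T + real T / 162 - 5 / 162
      \<le> arm_value (linear_base_demand 1 3) 2 2 T (markdown m 1 (5/6)) 1"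
    using markdown_value_ge[OF n] unfolding T by linarith
  also have "\<dots> \<le> arm_opt 1 (linear_base_demand 1 3) 2 2 T 1"
    by (intro arm_value_le_arm_opt) (auto simp: markdown_def)
  finally show ?thesis .
qed

theorem proposition1:
  shows "\<exists>(pbar::real) (a::real) (b::real) (\<eta>p::real) (\<eta>m::real) (r1::real).
    valid_instance pbar (linear_base_demand a b) \<eta>p \<eta>m \<and> \<eta>p = \<eta>m \<and> r1 \<in> {0..pbar} \<and>
    (\<exists>c>0. \<exists>T0::nat. \<forall>T\<ge>T0. \<forall>p\<in>{0..pbar}.
       arm_opt pbar (linear_base_demand a b) \<eta>p \<eta>m T r1
         - arm_value (linear_base_demand a b) \<eta>p \<eta>m T (\<lambda>_. p) r1 \<ge> c * real T)"
proof -
  have valid: "valid_instance 1 (linear_base_demand 1 3) 2 2"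
    by (rule valid_instance_loss_neutral) auto
  \<comment> \<open>Half of the surplus \<open>T / 162\<close> is kept; the other half covers the
    constants \<open>1 + 5 / 162\<close> exactly when \<open>T\<close> is at least 334.\<close>
  have gap: "1/324 * real T \<le> arm_opt 1 (linear_base_demand 1 3) 2 2 T 1
      - arm_value (linear_base_demand 1 3) 2 2 T (\<lambda>_. p) 1"
    if "334 \<le> T" "p \<in> {0..1}" for T p
    using arm_opt_ge[of T] fixed_price_value_le[OF that(2), of T] that(1)
    by linarith
  show ?thesis
    by (rule exI[of _ 1], rule exI[of _ 1], rule exI[of _ 3], rule exI[of _ 2], rule exI[of _ 2],
        rule exI[of _ 1], intro conjI valid, simp, simp, rule exI[of _ "1/324"], intro conjI,
        simp, rule exI[of _ 334], intro allI ballI impI gap)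
qed

end
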